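(* Let $n$ be a positive integer and let $\Delta$ be the checked triangular grid of order $n$ described in the context, with dark tiles, inscribed grid and overall grid as defined there. Let $S_n$ be the set of S-paths and $W_n$ the set of W-paths of order $n$. For an S-path $P$, let $\Phi(P)$ be the path on the inscribed grid that visits the centroids of the dark tiles in exactly the order in which the successive edges of $P$ lie on those tiles. Then $\Phi$ is a bijection from $S_n$ onto $W_n$. In particular $|W_n| = |S_n|$.
   Context: Take an equilateral triangle with corners $A$ (bottom-left), $B$ (bottom-right) and $C$ (top, lying counterclockwise from the ray $AB$), and divide each side into $n$ equal parts of unit length. Drawing the segments through the division points parallel to the sides partitions it into $n^2$ unit equilateral subtriangles; those facing upward (same orientation as $ABC$) are the dark tiles (there are $T_n=n(n+1)/2$ of them), the others are white. Every unit segment of this subdivision is a side of exactly one dark tile. Overall grid: the $T_{n+1}$ vertices of the subdivision (corners of the dark tiles). Inscribed grid: the $T_n$ centroids of the dark tiles; two such centroids are adjacent if they are at the minimal distance (the unit length), i.e. the inscribed grid is itself a triangular grid. Direction codes: a directed segment whose direction makes angle $d\pi/3$ (measured counterclockwise from the direction of $AB$) has direction code $d\in\{0,1,\dots,5\}$. H-path: a Hamiltonian path on the inscribed grid using only edges between adjacent centroids, starting at the leftmost centroid (that of the dark tile at corner $A$) and ending at the rightmost centroid (that of the dark tile at corner $B$). It is described by the string $h=d_1d_2\cdots d_{T_n-1}$ of direction codes of its consecutive edges. W-path (well-formed H-path): an H-path such that, writing the supplemented string $0\,d_1d_2\cdots d_{T_n-1}\,0$ as $e_0e_1\cdots e_{T_n}$,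 for every consecutive pair $(e_i,e_{i+1})$ we have $e_{i+1}\not\equiv e_i+4 \pmod 6$ if $e_i$ is even and $e_{i+1}\not\equiv e_i+2\pmod 6$ if $e_i$ is odd. S-path: a self-avoiding path (no repeated vertex) on the overall grid, from corner $A$ to corner $B$, consisting of exactly $T_n$ unit edges of the subdivision, such that the dark tiles on which its edges lie are pairwise distinct (so each dark tile carries exactly one edge of the path). *)

theory Defs
  imports Complex_Main "HOL-Number_Theory.Cong"
begin

text \<open>
  The triangle lies in the complex plane with \<open>A = 0\<close>, \<open>B = n\<close> and \<open>C = n * cis (pi / 3)\<close>.
  Paths are represented by the lists of the points they visit.
\<close>

definition triangular :: "nat \<Rightarrow> nat" where
  "triangular n = n * (n + 1) div 2"

definition grid_point :: "nat \<Rightarrow> nat \<Rightarrow> complex" where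
  "grid_point i j = of_nat i + of_nat j * cis (pi / 3)"

definition overall_grid :: "nat \<Rightarrow> complex set" where
  "overall_grid n = {grid_point i j | i j. i + j \<le> n}"

text \<open>
  A tile is represented by the set of its three corners, so that its sides are the
  segments between two distinct elements.
\<close>

definition dark_tile :: "complex \<Rightarrow> complex set" where
  "dark_tile z = {z, z + 1, z + cis (pi / 3)}"

definition dark_tiles :: "nat \<Rightarrow> complex set set" where
  "dark_tiles n = {dark_tile (grid_point i j) | i j. i + j < n}"

definition centroid :: "complex set \<Rightarrow> complex" where
  "centroid t = (\<Sum>z\<in>t. z) / of_nat (card t)"

definition inscribed_grid :: "nat \<Rightarrow> complex set" where
  "inscribed_grid n = centroid ` dark_tiles n"

definition direction_code :: "complex \<Rightarrow> complex \<Rightarrow> nat" where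
  "direction_code p q =
     (THE d. d < 6 \<and> q - p = of_real (dist p q) * cis (real d * pi / 3))"

definition directions :: "complex list \<Rightarrow> nat list" where
  "directions xs = map (\<lambda>(p, q). direction_code p q) (zip xs (tl xs))"

definition H_paths :: "nat \<Rightarrow> complex list set" where
  "H_paths n = {xs. xs \<noteq> [] \<and> distinct xs \<and> set xs = inscribed_grid n \<and>
     successively (\<lambda>p q. dist p q = 1) xs \<and>
     hd xs = centroid (dark_tile 0) \<and>
     last xs = centroid (dark_tile (of_nat (n - 1)))}"

definition allowed_turn :: "nat \<Rightarrow> nat \<Rightarrow> bool" where
  "allowed_turn e e' \<longleftrightarrow>
     (even e \<longrightarrow> \<not> [e' = e + 4] (mod 6)) \<and> (odd e \<longrightarrow> \<not> [e' = e + 2] (mod 6))"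

definition W_paths :: "nat \<Rightarrow> complex list set" where
  "W_paths n = {xs \<in> H_paths n. successively allowed_turn (0 # directions xs @ [0])}"

text \<open>
  The dark tile having the unit segment from \<open>p\<close> to \<open>q\<close> as a side; it is unique whenever
  \<open>p\<close> and \<open>q\<close> are points of the overall grid at distance 1.
\<close>

definition edge_tile :: "nat \<Rightarrow> complex \<Rightarrow> complex \<Rightarrow> complex set" where
  "edge_tile n p q = (THE t. t \<in> dark_tiles n \<and> p \<in> t \<and> q \<in> t)"

definition path_tiles :: "nat \<Rightarrow> complex list \<Rightarrow> complex set list" where
  "path_tiles n P = map (\<lambda>(p, q). edge_tile n p q) (zip P (tl P))"

definition S_paths :: "nat \<Rightarrow> complex list set" where
  "S_paths n = {P. distinct P \<and> set P \<subseteq> overall_grid n \<and>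
     successively (\<lambda>p q. dist p q = 1) P \<and>
     length P = triangular n + 1 \<and>
     hd P = 0 \<and> last P = of_nat n \<and>
     distinct (path_tiles n P)}"

definition Phi :: "nat \<Rightarrow> complex list \<Rightarrow> complex list" where
  "Phi n P = map centroid (path_tiles n P)"

end

theory Submission
  imports Defs
begin

text \<open>
  Every vertex \<open>v\<^sub>i\<close> of an S-path is the only common corner of the tiles \<open>t\<^sub>i\<close> and \<open>t\<^sub>i\<^sub>+\<^sub>1\<close>
  carrying the edges next to it, so the tile sequence determines the path. Conversely, a
  Hamiltonian path \<open>t\<^sub>1, t\<^sub>2, \<dots>\<close> on the tiles yields such common corners \<open>v\<^sub>i\<close>. The turn
  condition says exactly that \<open>v\<^sub>i\<^sub>-\<^sub>1 \<noteq> v\<^sub>i\<close>, and this already makes all the \<open>v\<^sub>i\<close> distinct,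
  because a vertex lies on at most three dark tiles whereas \<open>v\<^sub>i = v\<^sub>j\<close> with \<open>j > i + 1\<close> would
  put it on the four tiles \<open>t\<^sub>i, t\<^sub>i\<^sub>+\<^sub>1, t\<^sub>j, t\<^sub>j\<^sub>+\<^sub>1\<close>.
\<close>

section \<open>Sixth roots of unity and direction codes\<close>

abbreviation \<omega> :: complex where
  "\<omega> \<equiv> cis (pi / 3)"

lemma Re_omega: "Re \<omega> = 1 / 2" and Im_omega: "Im \<omega> = sqrt 3 / 2"
  by (simp_all add: cos_60 sin_60)

lemma omega_square: "\<omega> * \<omega> = \<omega> - 1"
  by (simp add: complex_eq_iff Re_omega Im_omega del: cis.sel cis_mult)

text \<open>Reduction by \<omega>^2 = \<omega> - 1 writes every power as an integer combination of 1
  and \<omega>. Case distinctions over codes below 6 then become linear computations.\<close>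

lemma omega_powers:
  "\<omega> ^ 0 = 1" "\<omega> ^ 1 = \<omega>" "\<omega> ^ 2 = \<omega> - 1" "\<omega> ^ 3 = -1" "\<omega> ^ 4 = - \<omega>" "\<omega> ^ 5 = 1 - \<omega>"
proof -
  show 2: "\<omega> ^ 2 = \<omega> - 1"
    unfolding power2_eq_square by (rule omega_square)
  have "\<omega> ^ 3 = \<omega> ^ 2 * \<omega>"
    by (simp only: power3_eq_cube power2_eq_square)
  also have "\<dots> = -1"
    unfolding 2 left_diff_distrib omega_square by simp
  finally show 3: "\<omega> ^ 3 = -1" .
  have "\<omega> ^ (3 + 1) = -\<omega>"
    unfolding power_add 3 by simp
  then show 4: "\<omega> ^ 4 = - \<omega>"
    by simp
  have "\<omega> ^ (3 + 2) = 1 - \<omega>"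
    unfolding power_add 3 2 by simp
  then show "\<omega> ^ 5 = 1 - \<omega>"
    by simp
qed simp_all

lemma less_6_cases: "(d::nat) < 6 \<Longrightarrow> d = 0 \<or> d = 1 \<or> d = 2 \<or> d = 3 \<or> d = 4 \<or> d = 5"
  by arith

lemma omega_distinct: "\<omega> \<noteq> 0" "\<omega> \<noteq> 1" "1 \<noteq> \<omega>"
  by (simp_all add: complex_eq_iff Re_omega Im_omega del: cis.sel)

lemma omega_power_inj:
  assumes "d < 6" "e < 6" "\<omega> ^ d = \<omega> ^ e"
  shows "d = e"
  using less_6_cases[OF assms(1)] less_6_cases[OF assms(2)] assms(3)
  by (elim disjE)
    (simp_all add: omega_powers complex_eq_iff Re_omega Im_omega del: cis.sel)

text \<open>A step by a power of \<omega> has length 1, so the factor \<open>dist p q\<close> in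
  \<open>direction_code\<close> disappears and uniqueness of the code is
  \<open>omega_power_inj\<close>.\<close>

lemma direction_code_eq:
  assumes "d < 6" "q - p = \<omega> ^ d"
  shows "direction_code p q = d"
proof -
  have cis: "cis (real e * pi / 3) = \<omega> ^ e" for e
    by (simp only: DeMoivre times_divide_eq_right)
  have "dist p q = 1"
    using assms(2) by (metis dist_commute dist_norm norm_cis norm_power power_one)
  then show ?thesis
    unfolding direction_code_def cis
    using assms omega_power_inj by (intro the_equality) auto
qed

section \<open>Common corners of dark tiles and turns\<close>

text \<open>
  Leaving a dark tile in direction \<open>d\<close> means passing through its corner at offset \<open>exit d\<close>,
  which is the corner at offset \<open>entry d\<close> of the next tile.
\<close>

definition exit :: "nat \<Rightarrow> complex" where
  "exit d = [1, \<omega>, \<omega>, 0, 0, 1] ! d"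

definition entry :: "nat \<Rightarrow> complex" where
  "entry d = [0, 0, 1, 1, \<omega>, \<omega>] ! d"

text \<open>If \<open>p\<close> has offset \<open>a\<close> in the first tile and \<open>b\<close>
  in the second, then \<open>z' - z = a - b\<close>. Equal offsets would force
  \<open>z = z'\<close>, and the six ordered pairs of distinct offsets from 0, 1, \<omega> produce
  exactly the six unit directions.\<close>

lemma common_corner:
  assumes "z \<noteq> z'" "p \<in> dark_tile z" "p \<in> dark_tile z'"
  obtains d where "d < 6" "z' - z = \<omega> ^ d" "direction_code z z' = d" "p = z + exit d" "p = z' + entry d"
proof -
  have "\<exists>d<6. z' - z = \<omega> ^ d \<and> p = z + exit d \<and> p = z' + entry d"
  proof -
    have "p = z \<or> p = z + 1 \<or> p = z + \<omega>" "p = z' \<or> p = z' + 1 \<or> p = z' + \<omega>"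
      using assms(2,3) by (auto simp: dark_tile_def)
    then consider "p = z + 1" "p = z'" | "p = z + \<omega>" "p = z'" | "p = z + \<omega>" "p = z' + 1"
      | "p = z" "p = z' + 1" | "p = z" "p = z' + \<omega>" | "p = z + 1" "p = z' + \<omega>"
      using assms(1) by auto
    then show ?thesis
    proof cases
      case 1
      then show ?thesis by (intro exI[of _ 0]) (simp add: exit_def entry_def)
    next
      case 2
      then show ?thesis by (intro exI[of _ 1]) (simp add: exit_def entry_def)
    next
      case 3
      then show ?thesis
        by (intro exI[of _ 2]) (simp add: omega_powers exit_def entry_def algebra_simps)
    next
      case 4
      then show ?thesis
        by (intro exI[of _ 3]) (simp add: omega_powers exit_def entry_def algebra_simps)
    next
      case 5
      then show ?thesis
        by (intro exI[of _ 4]) (simp add: omega_powers exit_def entry_def algebra_simps)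
    next
      case 6
      then show ?thesis
        by (intro exI[of _ 5]) (simp add: omega_powers exit_def entry_def algebra_simps)
    qed
  qed
  then show ?thesis
    using that direction_code_eq by blast
qed

text \<open>The direction from one base to the other already fixes the offset of any shared
  corner.\<close>

lemma common_corner_unique:
  assumes "z \<noteq> z'" "{p, q} \<subseteq> dark_tile z" "{p, q} \<subseteq> dark_tile z'"
  shows "p = q"
proof -
  have "p = z + exit (direction_code z z')" "q = z + exit (direction_code z z')"
    using assms common_corner[of z z'] by (metis insert_subset)+
  then show ?thesis by simp
qed

text \<open>For each \<open>d\<close>, exactly two codes \<open>e\<close> satisfy
  \<open>exit e = entry d\<close>: the turn forbidden after \<open>d\<close>, and the reversal
  \<open>d + 3\<close> modulo 6. The reversal would return to \<open>z\<^sub>0\<close>, which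
  \<open>z\<^sub>0 \<noteq> z\<^sub>2\<close> excludes.\<close>

lemma allowed_turn_iff:
  assumes "z\<^sub>0 \<noteq> z\<^sub>1" "z\<^sub>1 \<noteq> z\<^sub>2" "z\<^sub>0 \<noteq> z\<^sub>2"
    and "p \<in> dark_tile z\<^sub>0" "p \<in> dark_tile z\<^sub>1" "q \<in> dark_tile z\<^sub>1" "q \<in> dark_tile z\<^sub>2"
  shows "allowed_turn (direction_code z\<^sub>0 z\<^sub>1) (direction_code z\<^sub>1 z\<^sub>2) \<longleftrightarrow> p \<noteq> q"
proof -
  obtain d where d: "d < 6" "z\<^sub>1 - z\<^sub>0 = \<omega> ^ d" "direction_code z\<^sub>0 z\<^sub>1 = d" "p = z\<^sub>1 + entry d"
    using common_corner assms(1,4,5) by metis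
  obtain e where e: "e < 6" "z\<^sub>2 - z\<^sub>1 = \<omega> ^ e" "direction_code z\<^sub>1 z\<^sub>2 = e" "q = z\<^sub>1 + exit e"
    using common_corner assms(2,6,7) by metis
  have "z\<^sub>2 - z\<^sub>0 = \<omega> ^ e + \<omega> ^ d"
    unfolding d(2)[symmetric] e(2)[symmetric] by simp
  then have "\<omega> ^ e + \<omega> ^ d \<noteq> 0"
    using assms(3) by auto
  then have "allowed_turn d e \<longleftrightarrow> entry d \<noteq> exit e"
    using less_6_cases[OF d(1)] less_6_cases[OF e(1)]
    by (elim disjE) (simp_all add: omega_powers omega_distinct allowed_turn_def entry_def exit_def cong_def)
  then show ?thesis
    using d e by simp
qed

text \<open>A base is determined by \<open>p\<close> and by which of the three offsets
  \<open>p\<close> has in the tile.\<close>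

lemma card_tiles_at_point:
  assumes "finite Z" "\<And>z. z \<in> Z \<Longrightarrow> p \<in> dark_tile z"
  shows "card Z \<le> 3"
proof -
  have "Z \<subseteq> {p, p - 1, p - \<omega>}"
    using assms(2) by (fastforce simp: dark_tile_def eq_diff_eq)
  then have "card Z \<le> card {p, p - 1, p - \<omega>}"
    by (intro card_mono) auto
  also have "\<dots> \<le> 3"
    by (simp add: card_insert_if)
  finally show ?thesis .
qed

section \<open>Side lengths, centroids and grid coordinates\<close>

lemma dist_dark_tile:
  assumes "p \<in> dark_tile z" "q \<in> dark_tile z" "p \<noteq> q"
  shows "dist p q = 1"
proof -
  have "norm (\<omega> - 1) = 1"
    using omega_powers(3) by (metis norm_cis norm_power power_one)
  moreover from this have "norm (1 - \<omega>) = 1"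
    by (simp add: norm_minus_commute)
  ultimately show ?thesis
    using assms by (auto simp: dark_tile_def dist_norm)
qed

lemma centroid_dark_tile: "centroid (dark_tile z) = z + (1 + \<omega>) / 3"
proof -
  have "z \<noteq> z + 1" "z \<noteq> z + \<omega>" "z + 1 \<noteq> z + \<omega>"
    using omega_distinct by auto
  then show ?thesis
    by (simp add: centroid_def dark_tile_def field_simps)
qed

lemma dark_tile_inj: "dark_tile z = dark_tile z' \<longleftrightarrow> z = z'"
  by (metis add_right_cancel centroid_dark_tile)

text \<open>The lower left corners stand in for the dark tiles. By \<open>centroid_dark_tile\<close>
  the inscribed grid is a translate of this set, so distances and direction codes of centroids can
  be computed on bases.\<close>

definition tile_bases :: "nat \<Rightarrow> complex set" where
  "tile_bases n = {grid_point i j | i j. i + j < n}"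

lemma dark_tiles_altdef: "dark_tiles n = dark_tile ` tile_bases n"
  by (auto simp: dark_tiles_def tile_bases_def)

lemma grid_point_eq_iff: "grid_point i j = grid_point k l \<longleftrightarrow> i = k \<and> j = l"
  by (auto simp: grid_point_def complex_eq_iff Re_omega Im_omega simp del: cis.sel)

lemma grid_point_Suc:
  "grid_point (Suc i) j = grid_point i j + 1" "grid_point i (Suc j) = grid_point i j + \<omega>"
  by (simp_all add: grid_point_def algebra_simps)

lemma dark_tile_grid_point:
  "dark_tile (grid_point i j) = {grid_point i j, grid_point (Suc i) j, grid_point i (Suc j)}"
  by (simp add: dark_tile_def grid_point_Suc)

lemma corner_in_overall_grid:
  "z \<in> tile_bases n \<Longrightarrow> p \<in> dark_tile z \<Longrightarrow> p \<in> overall_grid n"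
  by (fastforce simp: tile_bases_def overall_grid_def dark_tile_grid_point)

lemma tile_bases_altdef:
  "tile_bases n = (\<lambda>(i, j). grid_point i j) ` (SIGMA i:{..<n}. {..<n - i})"
  by (force simp: tile_bases_def)

lemma finite_tile_bases: "finite (tile_bases n)"
  by (simp add: tile_bases_altdef)

lemma card_tile_bases: "card (tile_bases n) = triangular n"
proof -
  have "card (tile_bases n) = (\<Sum>i<n. n - i)"
    unfolding tile_bases_altdef
    by (subst card_image) (auto simp: inj_on_def grid_point_eq_iff)
  also have "\<dots> = (\<Sum>i\<in>{1..n}. i)"
    by (rule sum.reindex_bij_witness[of _ "\<lambda>i. n - i" "\<lambda>i. n - i"]) auto
  also have "\<dots> = \<Sum>{0..n}"
    by (intro sum.mono_neutral_left) auto
  also have "\<dots> = triangular n"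
    by (simp add: gauss_sum_nat triangular_def)
  finally show ?thesis .
qed

text \<open>In coordinates relative to 1 and \<omega> the squared distance is the form a^2 + a b +
  b^2, which takes the value 1 at exactly six integer points.\<close>

lemma sides_in_dark_tile:
  assumes "p \<in> overall_grid n" "q \<in> overall_grid n" "dist p q = 1"
  shows "\<exists>z\<in>tile_bases n. p \<in> dark_tile z \<and> q \<in> dark_tile z"
proof -
  obtain i j where p: "p = grid_point i j" "i + j \<le> n"
    using assms(1) by (auto simp: overall_grid_def)
  obtain k l where q: "q = grid_point k l" "k + l \<le> n"
    using assms(2) by (auto simp: overall_grid_def)
  define a b where "a = int k - int i" and "b = int l - int j"
  have "q - p = of_int a + of_int b * \<omega>"
    by (simp add: p q grid_point_def a_def b_def algebra_simps)
  then have "dist q p = norm (of_int a + of_int b * \<omega>)"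
    by (simp add: dist_norm)
  then have "(dist p q)\<^sup>2 = (a + b / 2)\<^sup>2 + (b * sqrt 3 / 2)\<^sup>2"
    by (simp add: dist_commute[of p] cmod_power2 Re_omega Im_omega del: cis.sel)
  also have "\<dots> = real_of_int (a * a + a * b + b * b)"
    by (simp add: power2_eq_square algebra_simps)
  finally have ab: "a * a + a * b + b * b = 1"
    using assms(3) by (metis of_int_eq_1_iff power_one)
  have "a = 1 \<and> b = 0 \<or> a = 0 \<and> b = 1 \<or> a = -1 \<and> b = 1 \<or>
      a = -1 \<and> b = 0 \<or> a = 0 \<and> b = -1 \<or> a = 1 \<and> b = -1"
  proof -
    \<comment> \<open>Completing the square bounds 3 b^2 and 3 a^2 by 4, so both integers lie
      between -1 and 1.\<close>
    have "4 * (a * a + a * b + b * b) = (2 * a + b)\<^sup>2 + 3 * b\<^sup>2"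
      "4 * (a * a + a * b + b * b) = (2 * b + a)\<^sup>2 + 3 * a\<^sup>2"
      by (simp_all add: power2_eq_square algebra_simps)
    then have "b\<^sup>2 \<le> 1" "a\<^sup>2 \<le> 1"
      unfolding ab using zero_le_power2[of "2 * a + b"] zero_le_power2[of "2 * b + a"] by linarith+
    then have "\<bar>a\<bar> \<le> 1" "\<bar>b\<bar> \<le> 1"
      by (simp_all only: abs_square_le_1)
    then have "a = -1 \<or> a = 0 \<or> a = 1" "b = -1 \<or> b = 0 \<or> b = 1"
      by auto
    then show ?thesis
      using ab by auto
  qed
  then have "k = Suc i \<and> l = j \<or> k = i \<and> l = Suc j \<or> i = Suc k \<and> l = Suc j
      \<or> i = Suc k \<and> l = j \<or> k = i \<and> j = Suc l \<or> k = Suc i \<and> j = Suc l"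
    unfolding a_def b_def by (elim disjE) simp_all
  then consider "k = Suc i" "l = j" | "k = i" "l = Suc j" | "i = Suc k" "l = Suc j"
    | "i = Suc k" "l = j" | "k = i" "j = Suc l" | "k = Suc i" "j = Suc l"
    by blast
  \<comment> \<open>In every case the base of the tile has as coordinates the minima of the
    coordinates of \<open>p\<close> and \<open>q\<close>.\<close>
  then have "\<exists>i' j'. i' + j' < n \<and> p \<in> dark_tile (grid_point i' j') \<and> q \<in> dark_tile (grid_point i' j')"
  proof cases
    case 1
    then show ?thesis using p q by (intro exI[of _ i] exI[of _ j]) (simp add: dark_tile_grid_point)
  next
    case 2
    then show ?thesis using p q by (intro exI[of _ i] exI[of _ j]) (simp add: dark_tile_grid_point)
  next
    case 3
    then show ?thesis using p q by (intro exI[of _ k] exI[of _ j]) (simp add: dark_tile_grid_point)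
  next
    case 4
    then show ?thesis using p q by (intro exI[of _ k] exI[of _ j]) (simp add: dark_tile_grid_point)
  next
    case 5
    then show ?thesis using p q by (intro exI[of _ k] exI[of _ l]) (simp add: dark_tile_grid_point)
  next
    case 6
    then show ?thesis using p q by (intro exI[of _ i] exI[of _ l]) (simp add: dark_tile_grid_point)
  qed
  then show ?thesis
    by (auto simp: tile_bases_def)
qed

text \<open>Distinct tiles share at most one corner, so the definite description in
  \<open>edge_tile\<close> has only one candidate.\<close>

lemma edge_tile_eq:
  assumes "z \<in> tile_bases n" "p \<in> dark_tile z" "q \<in> dark_tile z" "p \<noteq> q"
  shows "edge_tile n p q = dark_tile z"
  unfolding edge_tile_def
proof (rule the_equality)
  show "dark_tile z \<in> dark_tiles n \<and> p \<in> dark_tile z \<and> q \<in> dark_tile z"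
    using assms by (simp add: dark_tiles_altdef)
next
  fix t
  assume "t \<in> dark_tiles n \<and> p \<in> t \<and> q \<in> t"
  then obtain z' where "t = dark_tile z'" "p \<in> dark_tile z'" "q \<in> dark_tile z'"
    by (auto simp: dark_tiles_altdef)
  then show "t = dark_tile z"
    using assms(2-4) common_corner_unique[of z z' p q] by auto
qed

section \<open>The corners A and B and the outer tiles touching them\<close>

lemma grid_point_origin: "grid_point 0 0 = 0"
  and grid_point_bottom: "grid_point m 0 = of_nat m"
  by (simp_all add: grid_point_def)

lemma origin_in_dark_tile:
  assumes "z \<in> tile_bases n" "0 \<in> dark_tile z"
  shows "z = 0"
proof -
  obtain i j where z: "z = grid_point i j"
    using assms(1) by (auto simp: tile_bases_def)
  have "grid_point 0 0 \<in> dark_tile z"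
    using assms(2) by (simp add: grid_point_origin)
  then have "i = 0" "j = 0"
    unfolding z dark_tile_grid_point by (auto simp: grid_point_eq_iff)
  then show ?thesis
    by (simp add: z grid_point_origin)
qed

lemma right_corner_in_dark_tile:
  assumes "z \<in> tile_bases n" "of_nat n \<in> dark_tile z"
  shows "z = of_nat (n - 1)"
proof -
  obtain i j where z: "z = grid_point i j" and ij: "i + j < n"
    using assms(1) by (auto simp: tile_bases_def)
  have "grid_point n 0 \<in> dark_tile z"
    using assms(2) by (simp add: grid_point_bottom)
  then have "i = n - 1" "j = 0"
    using ij unfolding z dark_tile_grid_point by (auto simp: grid_point_eq_iff)
  then show ?thesis
    by (simp add: z grid_point_bottom)
qed

lemma outer_left_tile:
  assumes "p \<in> overall_grid n" "p \<in> dark_tile (-1)"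
  shows "p = 0"
proof -
  obtain i j where p: "p = grid_point i j"
    using assms(1) by (auto simp: overall_grid_def)
  \<comment> \<open>The shift by 1 gives the outer tile natural coordinates, as
    \<open>grid_point\<close> requires.\<close>
  have "p + 1 \<in> {grid_point 0 0, grid_point 1 0, grid_point 0 1}"
    using assms(2) by (auto simp: dark_tile_def grid_point_def)
  then have "i = 0" "j = 0"
    unfolding p grid_point_Suc[symmetric] by (auto simp: grid_point_eq_iff)
  then show ?thesis
    by (simp add: p grid_point_origin)
qed

lemma outer_right_tile:
  assumes "p \<in> overall_grid n" "p \<in> dark_tile (of_nat n)"
  shows "p = of_nat n"
proof -
  obtain i j where p: "p = grid_point i j" and "i + j \<le> n"
    using assms(1) by (auto simp: overall_grid_def)
  moreover have "p \<in> dark_tile (grid_point n 0)"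
    using assms(2) by (simp add: grid_point_bottom)
  ultimately have "i = n" "j = 0"
    unfolding p dark_tile_grid_point by (auto simp: grid_point_eq_iff)
  then show ?thesis
    by (simp add: p grid_point_bottom)
qed

lemma outer_tiles_not_in_tile_bases: "-1 \<notin> tile_bases n" "of_nat n \<notin> tile_bases n"
proof -
  have "-1 \<noteq> grid_point i j" for i j
  proof
    assume "-1 = grid_point i j"
    then have "grid_point (Suc i) j = grid_point 0 0"
      unfolding grid_point_Suc grid_point_origin by (metis add.left_inverse)
    then show False
      by (simp add: grid_point_eq_iff)
  qed
  then show "-1 \<notin> tile_bases n"
    by (auto simp: tile_bases_def)
  show "of_nat n \<notin> tile_bases n"
    by (auto simp: tile_bases_def grid_point_eq_iff simp flip: grid_point_bottom)
qed

section \<open>Adjacency of tiles as having a common corner\<close>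

text \<open>The two bases span an edge of the overall grid, hence are corners of one dark tile, with
  base \<open>y\<close>. If one of them is \<open>y\<close>, the other is the common corner; if they
  are \<open>y + 1\<close> and \<open>y + \<omega>\<close>, it is
  \<open>y + 1 + \<omega>\<close>.\<close>

lemma adjacent_tiles_meet:
  assumes "z \<in> tile_bases n" "z' \<in> tile_bases n" "dist z z' = 1"
  shows "\<exists>p. p \<in> dark_tile z \<and> p \<in> dark_tile z'"
proof -
  have "z \<in> overall_grid n" "z' \<in> overall_grid n"
    using assms(1,2) by (auto intro: corner_in_overall_grid simp: dark_tile_def)
  then obtain y where "z \<in> dark_tile y" "z' \<in> dark_tile y"
    using sides_in_dark_tile assms(3) by blast
  then have "z = y \<or> z = y + 1 \<or> z = y + \<omega>" "z' = y \<or> z' = y + 1 \<or> z' = y + \<omega>"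
    by (auto simp: dark_tile_def)
  moreover have "{y + 1, y + \<omega>} \<subseteq> dark_tile y" "{y + 1, y + 1 + \<omega>} \<subseteq> dark_tile (y + 1)"
    "{y + \<omega>, y + 1 + \<omega>} \<subseteq> dark_tile (y + \<omega>)"
    by (simp_all add: dark_tile_def)
  ultimately show ?thesis
    by blast
qed

lemma dist_meeting_tiles:
  assumes "z \<noteq> z'" "p \<in> dark_tile z" "p \<in> dark_tile z'"
  shows "dist z z' = 1"
proof -
  obtain d where "z' - z = \<omega> ^ d"
    using assms common_corner by metis
  then show ?thesis
    by (metis dist_commute dist_norm norm_cis norm_power power_one)
qed

section \<open>Direction strings of lists of points\<close>

lemma successively_conv_nth:
  "successively R xs \<longleftrightarrow> (\<forall>i. Suc i < length xs \<longrightarrow> R (xs ! i) (xs ! Suc i))"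
proof (induction R xs rule: successively.induct)
  case (3 R x y xs)
  then show ?case
    by (auto simp: nth_Cons split: nat.splits)
qed simp_all

lemma length_directions: "length (directions xs) = length xs - 1"
  by (simp add: directions_def)

lemma nth_directions:
  "Suc i < length xs \<Longrightarrow> directions xs ! i = direction_code (xs ! i) (xs ! Suc i)"
  by (simp add: directions_def nth_tl)

lemma directions_translate: "directions (map (\<lambda>z. z + c) zs) = directions zs"
  by (intro nth_equalityI) (simp_all add: length_directions nth_directions direction_code_def)

lemma directions_Cons: "xs \<noteq> [] \<Longrightarrow> directions (x # xs) = direction_code x (hd xs) # directions xs"
  by (cases xs) (simp_all add: directions_def)

lemma directions_snoc: "xs \<noteq> [] \<Longrightarrow> directions (xs @ [y]) = directions xs @ [direction_code (last xs) y]"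
proof (induction xs)
  case (Cons x xs)
  then show ?case
    by (cases "xs = []") (simp_all add: directions_Cons, simp add: directions_def)
qed simp

section \<open>Tile sequences interlaced with vertex paths\<close>

text \<open>
  The two outer dark tiles touching the triangle at \<open>A\<close> and \<open>B\<close> turn the first and last vertex
  of a path into common corners of consecutive tiles, and the two extra codes \<open>0\<close> of the
  supplemented string into ordinary directions.
\<close>

definition supplemented :: "nat \<Rightarrow> complex list \<Rightarrow> complex list" where
  "supplemented n zs = -1 # zs @ [of_nat n]"

lemma directions_supplemented:
  assumes "n \<ge> 1" "zs \<noteq> []" "hd zs = 0" "last zs = of_nat (n - 1)"
  shows "directions (supplemented n zs) = 0 # directions zs @ [0]"
proof -
  have "direction_code (-1) 0 = 0" "direction_code (of_nat (n - 1)) (of_nat n) = 0"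
    using assms(1) by (auto intro!: direction_code_eq simp: of_nat_diff)
  then show ?thesis
    using assms by (simp add: supplemented_def directions_Cons directions_snoc)
qed

definition covering :: "nat \<Rightarrow> complex list \<Rightarrow> bool" where
  "covering n zs \<longleftrightarrow> distinct zs \<and> set zs = tile_bases n"

text \<open>The prepended outer tile shifts indices by one: for \<open>0 < i < length zs\<close>,
  vertex \<open>i\<close> is shared by \<open>zs ! (i - 1)\<close> and \<open>zs ! i\<close>. At the
  two ends an outer tile replaces the missing one. For distinct tiles a shared corner also encodes
  adjacency.\<close>

definition interlaced :: "nat \<Rightarrow> complex list \<Rightarrow> complex list \<Rightarrow> bool" where
  "interlaced n zs P \<longleftrightarrow> length P = Suc (length zs) \<and>
     (\<forall>i\<le>length zs. P ! i \<in> dark_tile (supplemented n zs ! i) \<and>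
        P ! i \<in> dark_tile (supplemented n zs ! Suc i))"

lemma length_supplemented: "length (supplemented n zs) = length zs + 2"
  by (simp add: supplemented_def)

lemma nth_supplemented:
  "supplemented n zs ! 0 = -1"
  "i < length zs \<Longrightarrow> supplemented n zs ! Suc i = zs ! i"
  "supplemented n zs ! Suc (length zs) = of_nat n"
  by (simp_all add: supplemented_def nth_append)

lemma distinct_supplemented:
  assumes "covering n zs"
  shows "distinct (supplemented n zs)"
proof -
  have "(-1::complex) \<noteq> of_nat n"
    by (simp add: complex_eq_iff)
  then show ?thesis
    using assms outer_tiles_not_in_tile_bases
    by (auto simp: supplemented_def covering_def)
qed

lemma interlaced_tile:
  assumes "interlaced n zs P" "i < length zs"
  shows "P ! i \<in> dark_tile (zs ! i)" "P ! Suc i \<in> dark_tile (zs ! i)"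
proof -
  show "P ! i \<in> dark_tile (zs ! i)"
    using assms unfolding interlaced_def by (metis less_imp_le nth_supplemented(2))
  show "P ! Suc i \<in> dark_tile (zs ! i)"
    using assms unfolding interlaced_def by (metis Suc_leI nth_supplemented(2))
qed

lemma length_covering: "covering n zs \<Longrightarrow> length zs = triangular n"
  unfolding covering_def by (metis card_tile_bases distinct_card)

lemma covering_nonempty:
  assumes "n \<ge> 1" "covering n zs"
  shows "length zs > 0"
proof -
  have "2 \<le> n * (n + 1)"
    using assms(1) mult_le_mono[of 1 n 2 "n + 1"] by simp
  then show ?thesis
    using length_covering[OF assms(2)] by (simp add: triangular_def)
qed

text \<open>Each outer tile meets the overall grid only at A or only at B, which fixes the end
  vertices. Each of these corners lies on a single tile of the grid, which fixes the end
  tiles.\<close>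

lemma interlaced_ends:
  assumes "n \<ge> 1" "covering n zs" "interlaced n zs P"
  shows "hd P = 0" "last P = of_nat n" "hd zs = 0" "last zs = of_nat (n - 1)"
proof -
  define m where "m = length zs - 1"
  have len: "length zs = Suc m" and lenP: "length P = Suc (Suc m)"
    using covering_nonempty[OF assms(1,2)] assms(3) by (auto simp: m_def interlaced_def)
  have bases: "zs ! 0 \<in> tile_bases n" "zs ! m \<in> tile_bases n"
    using assms(2) len nth_mem[of _ zs] by (auto simp: covering_def)
  have outer: "P ! 0 \<in> dark_tile (-1)" "P ! Suc m \<in> dark_tile (of_nat n)"
    using assms(3) len nth_supplemented(1,3)[of n zs] by (auto simp: interlaced_def)
  have inner: "P ! 0 \<in> dark_tile (zs ! 0)" "P ! Suc m \<in> dark_tile (zs ! m)"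
    using interlaced_tile[OF assms(3)] len by auto
  have P: "P ! 0 = 0" "P ! Suc m = of_nat n"
    using bases inner outer corner_in_overall_grid outer_left_tile outer_right_tile by blast+
  have zs: "zs ! 0 = 0" "zs ! m = of_nat (n - 1)"
    using bases inner P origin_in_dark_tile right_corner_in_dark_tile by metis+
  have ne: "P \<noteq> []" "zs \<noteq> []"
    using len lenP by auto
  show "hd P = 0" "last P = of_nat n" "hd zs = 0" "last zs = of_nat (n - 1)"
    using P zs by (simp_all add: hd_conv_nth last_conv_nth ne len lenP)
qed

text \<open>The bound of three tiles at a point holds in the whole plane, so the count of four tiles
  remains valid at the ends, where outer tiles may be among them.\<close>

lemma distinct_interlaced_iff:
  assumes "covering n zs" "interlaced n zs P"
  shows "distinct P \<longleftrightarrow> (\<forall>i<length zs. P ! i \<noteq> P ! Suc i)"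
proof
  assume "distinct P"
  then show "\<forall>i<length zs. P ! i \<noteq> P ! Suc i"
    using assms(2) by (auto simp: interlaced_def nth_eq_iff_index_eq)
next
  assume step: "\<forall>i<length zs. P ! i \<noteq> P ! Suc i"
  let ?t = "supplemented n zs"
  have neq: "P ! i \<noteq> P ! j" if "i < j" "j \<le> length zs" for i j
  proof
    assume eq: "P ! i = P ! j"
    then have "Suc i \<noteq> j"
      using step that by auto
    then have "card ((!) ?t ` {i, Suc i, j, Suc j}) = card {i, Suc i, j, Suc j}"
      using distinct_supplemented[OF assms(1)] that
      by (intro card_image inj_on_nth) (auto simp: length_supplemented)
    moreover have "card {i, Suc i, j, Suc j} = 4"
      using that \<open>Suc i \<noteq> j\<close> by (simp add: card_insert_if)
    moreover have "card ((!) ?t ` {i, Suc i, j, Suc j}) \<le> 3"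
    proof (rule card_tiles_at_point)
      have "P ! i \<in> dark_tile (?t ! i)" "P ! i \<in> dark_tile (?t ! Suc i)"
        "P ! i \<in> dark_tile (?t ! j)" "P ! i \<in> dark_tile (?t ! Suc j)"
        using assms(2) that eq by (metis interlaced_def less_imp_le le_trans)+
      then show "P ! i \<in> dark_tile z" if "z \<in> (!) ?t ` {i, Suc i, j, Suc j}" for z
        using that by auto
    qed simp
    ultimately show False
      by simp
  qed
  have "P ! i \<noteq> P ! j" if "i < length P" "j < length P" "i \<noteq> j" for i j
    using that assms(2) neq[of i j] neq[of j i]
    by (cases i j rule: linorder_cases) (auto simp: interlaced_def)
  then show "distinct P"
    by (simp add: distinct_conv_nth)
qed

text \<open>Turn \<open>i\<close> of the supplemented string involves three consecutive supplemented
  tiles, whose successive common corners are \<open>P ! i\<close> and \<open>P ! Suc i\<close>. By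
  \<open>allowed_turn_iff\<close> all turns are allowed iff consecutive vertices differ.\<close>

lemma well_formed_iff_distinct:
  assumes "n \<ge> 1" "covering n zs" "interlaced n zs P"
  shows "successively allowed_turn (0 # directions zs @ [0]) \<longleftrightarrow> distinct P"
proof -
  let ?t = "supplemented n zs"
  have "zs \<noteq> []"
    using covering_nonempty[OF assms(1,2)] by auto
  then have dirs: "0 # directions zs @ [0] = directions ?t"
    using directions_supplemented interlaced_ends(3,4)[OF assms] assms(1) by simp
  have "allowed_turn (directions ?t ! i) (directions ?t ! Suc i) \<longleftrightarrow> P ! i \<noteq> P ! Suc i"
    if "i < length zs" for i
  proof -
    have "?t ! i \<noteq> ?t ! Suc i" "?t ! Suc i \<noteq> ?t ! Suc (Suc i)" "?t ! i \<noteq> ?t ! Suc (Suc i)"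
      using distinct_supplemented[OF assms(2)] that
      by (simp_all add: nth_eq_iff_index_eq length_supplemented)
    moreover have "P ! i \<in> dark_tile (?t ! i)" "P ! i \<in> dark_tile (?t ! Suc i)"
      "P ! Suc i \<in> dark_tile (?t ! Suc i)" "P ! Suc i \<in> dark_tile (?t ! Suc (Suc i))"
      using assms(3) that by (auto simp: interlaced_def)
    ultimately show ?thesis
      using that allowed_turn_iff by (simp add: nth_directions length_supplemented)
  qed
  then show ?thesis
    unfolding dirs distinct_interlaced_iff[OF assms(2,3)] successively_conv_nth
    by (auto simp: length_directions length_supplemented)
qed

section \<open>Tours as the link between S-paths and W-paths\<close>

lemma path_tiles_eq:
  assumes "length P = Suc (length zs)" "distinct P" "set zs \<subseteq> tile_bases n"
    and "\<And>i. i < length zs \<Longrightarrow> P ! i \<in> dark_tile (zs ! i) \<and> P ! Suc i \<in> dark_tile (zs ! i)"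
  shows "path_tiles n P = map dark_tile zs"
proof (rule nth_equalityI)
  show "length (path_tiles n P) = length (map dark_tile zs)"
    using assms(1) by (simp add: path_tiles_def)
next
  fix i
  assume "i < length (path_tiles n P)"
  then have i: "i < length zs"
    using assms(1) by (simp add: path_tiles_def)
  have "P ! i \<noteq> P ! Suc i"
    using assms(1,2) i by (simp add: nth_eq_iff_index_eq)
  then have "edge_tile n (P ! i) (P ! Suc i) = dark_tile (zs ! i)"
    using assms(3,4) i edge_tile_eq nth_mem by blast
  then show "path_tiles n P ! i = map dark_tile zs ! i"
    using assms(1) i by (simp add: path_tiles_def nth_tl)
qed

text \<open>Both kinds of path are views of this pair: \<open>P\<close> is the S-path, the translate
  of \<open>zs\<close> to centroids is the W-path, and \<open>Phi\<close> leads from the first to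
  the second. It remains to extend each kind of path to a tour and to see that \<open>zs\<close>
  determines \<open>P\<close>.\<close>

definition tour :: "nat \<Rightarrow> complex list \<Rightarrow> complex list \<Rightarrow> bool" where
  "tour n zs P \<longleftrightarrow> covering n zs \<and> interlaced n zs P \<and> distinct P"

lemma tour_path_tiles: "tour n zs P \<Longrightarrow> path_tiles n P = map dark_tile zs"
  by (intro path_tiles_eq) (auto simp: tour_def covering_def interlaced_def interlaced_tile)

lemma tour_Phi: "tour n zs P \<Longrightarrow> Phi n P = map (\<lambda>z. z + (1 + \<omega>) / 3) zs"
  by (simp add: Phi_def tour_path_tiles centroid_dark_tile)

lemma tour_in_S_paths:
  assumes "n \<ge> 1" "tour n zs P"
  shows "P \<in> S_paths n"
proof -
  have t: "covering n zs" "interlaced n zs P" "distinct P"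
    using assms(2) by (auto simp: tour_def)
  have len: "length P = Suc (length zs)"
    using t(2) by (simp add: interlaced_def)
  note ends = interlaced_ends[OF assms(1) t(1,2)]
  have "P ! i \<in> overall_grid n" if "i < length P" for i
  proof (cases "i < length zs")
    case True
    then show ?thesis
      using t(1) interlaced_tile[OF t(2)] corner_in_overall_grid nth_mem
      unfolding covering_def by blast
  next
    case False
    then have "P ! i = last P"
      using that len by (cases "P = []") (auto simp: last_conv_nth less_Suc_eq)
    then have "P ! i = grid_point n 0 \<and> n + 0 \<le> n"
      using ends by (simp add: grid_point_bottom)
    then show ?thesis
      unfolding overall_grid_def by blast
  qed
  then have "set P \<subseteq> overall_grid n"
    by (auto simp: in_set_conv_nth)
  moreover have "successively (\<lambda>p q. dist p q = 1) P"
    unfolding successively_conv_nth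
  proof (intro allI impI)
    fix i
    assume "Suc i < length P"
    then show "dist (P ! i) (P ! Suc i) = 1"
      using interlaced_tile[OF t(2), of i] t(3) len
      by (intro dist_dark_tile) (auto simp: nth_eq_iff_index_eq)
  qed
  moreover have "distinct (path_tiles n P)"
    using t(1) by (simp add: tour_path_tiles[OF assms(2)] distinct_map covering_def inj_on_def dark_tile_inj)
  ultimately show ?thesis
    using t ends len length_covering by (simp add: S_paths_def)
qed

text \<open>A tile is chosen for each edge. Distinctness of \<open>path_tiles\<close> makes the
  chosen tiles distinct, and since their number is that of all dark tiles, they exhaust the
  grid.\<close>

lemma S_path_tour:
  assumes "P \<in> S_paths n"
  obtains zs where "tour n zs P"
proof -
  define N where "N = triangular n"
  have "P \<noteq> []"
    using assms by (auto simp: S_paths_def)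
  have P: "distinct P" "set P \<subseteq> overall_grid n" "\<And>i. i < N \<Longrightarrow> dist (P ! i) (P ! Suc i) = 1"
    "length P = Suc N" "P ! 0 = 0" "P ! N = of_nat n" "distinct (path_tiles n P)"
    using assms \<open>P \<noteq> []\<close> hd_conv_nth[of P] last_conv_nth[of P]
    by (auto simp: S_paths_def N_def successively_conv_nth)
  have "\<exists>z. z \<in> tile_bases n \<and> P ! i \<in> dark_tile z \<and> P ! Suc i \<in> dark_tile z" if "i < N" for i
  proof -
    have "P ! i \<in> overall_grid n" "P ! Suc i \<in> overall_grid n"
      using that P(2,4) nth_mem[of _ P] by auto
    then show ?thesis
      using sides_in_dark_tile P(3)[OF that] by blast
  qed
  then obtain f where f: "\<And>i. i < N \<Longrightarrow> f i \<in> tile_bases n"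
    "\<And>i. i < N \<Longrightarrow> P ! i \<in> dark_tile (f i)" "\<And>i. i < N \<Longrightarrow> P ! Suc i \<in> dark_tile (f i)"
    by metis
  define zs where "zs = map f [0..<N]"
  have len: "length zs = N" and nth: "\<And>i. i < N \<Longrightarrow> zs ! i = f i"
    by (simp_all add: zs_def)
  have sub: "set zs \<subseteq> tile_bases n"
    using f(1) by (auto simp: zs_def)
  have "path_tiles n P = map dark_tile zs"
    using P sub f by (intro path_tiles_eq) (auto simp: len nth)
  then have dist: "distinct zs"
    using P(7) by (simp add: distinct_map)
  then have "set zs = tile_bases n"
    using sub len by (intro card_subset_eq) (simp_all add: finite_tile_bases card_tile_bases N_def distinct_card)
  then have "covering n zs"
    using dist by (simp add: covering_def)
  moreover have "interlaced n zs P"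
    unfolding interlaced_def
  proof (intro conjI allI impI)
    show "length P = Suc (length zs)"
      by (simp add: P len)
    fix i
    assume i: "i \<le> length zs"
    \<comment> \<open>For \<open>i = 0\<close> the vertex 0 is the corner \<open>-1 + 1\<close> of
      the left outer tile; otherwise it ends the edge on the preceding tile.\<close>
    show "P ! i \<in> dark_tile (supplemented n zs ! i)"
      using i f(3) by (cases i) (simp_all add: nth_supplemented len nth P dark_tile_def)
    show "P ! i \<in> dark_tile (supplemented n zs ! Suc i)"
    proof (cases "i = length zs")
      case True
      then show ?thesis
        by (simp only: nth_supplemented) (simp add: len P dark_tile_def)
    next
      case False
      then show ?thesis
        using i f(2) by (simp add: nth_supplemented len nth)
    qed
  qed
  ultimately show ?thesis
    using that P(1) by (simp add: tour_def)
qed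

text \<open>Each vertex is a common corner of two distinct consecutive supplemented tiles, and such
  a corner is unique.\<close>

lemma tour_unique:
  assumes "n \<ge> 1" "tour n zs P" "tour n zs Q"
  shows "P = Q"
proof (rule nth_equalityI)
  show "length P = length Q"
    using assms by (simp add: tour_def interlaced_def)
next
  fix i
  assume "i < length P"
  then have i: "i \<le> length zs"
    using assms by (simp add: tour_def interlaced_def)
  have "supplemented n zs ! i \<noteq> supplemented n zs ! Suc i"
    using distinct_supplemented assms(2) i
    by (simp add: tour_def nth_eq_iff_index_eq length_supplemented)
  then show "P ! i = Q ! i"
    using assms(2,3) i by (intro common_corner_unique) (auto simp: tour_def interlaced_def)
qed

lemma inscribed_grid_altdef: "inscribed_grid n = (\<lambda>z. z + (1 + \<omega>) / 3) ` tile_bases n"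
  by (simp add: inscribed_grid_def dark_tiles_altdef image_image centroid_dark_tile)

lemma tour_in_W_paths:
  assumes "n \<ge> 1" "tour n zs P"
  shows "map (\<lambda>z. z + (1 + \<omega>) / 3) zs \<in> W_paths n"
proof -
  have t: "covering n zs" "interlaced n zs P" "distinct P"
    using assms(2) by (auto simp: tour_def)
  note ends = interlaced_ends[OF assms(1) t(1,2)]
  have ne: "zs \<noteq> []"
    using covering_nonempty[OF assms(1) t(1)] by auto
  have "dist (zs ! i) (zs ! Suc i) = 1" if "Suc i < length zs" for i
    using that t(1) interlaced_tile[OF t(2)]
    by (intro dist_meeting_tiles[of _ _ "P ! Suc i"]) (auto simp: covering_def nth_eq_iff_index_eq)
  then have "successively (\<lambda>p q. dist p q = 1) zs"
    by (simp add: successively_conv_nth)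
  moreover have "successively allowed_turn (0 # directions zs @ [0])"
    using well_formed_iff_distinct[OF assms(1) t(1,2)] t(3) by simp
  ultimately show ?thesis
    using t(1) ne ends
    by (simp add: W_paths_def H_paths_def directions_translate inscribed_grid_altdef
        successively_map hd_map last_map centroid_dark_tile covering_def distinct_map inj_on_def)
qed

text \<open>Vertices are chosen as common corners of consecutive supplemented tiles; the turn
  condition then makes them distinct.\<close>

lemma W_path_tour:
  assumes "n \<ge> 1" "xs \<in> W_paths n"
  obtains zs P where "tour n zs P" "xs = map (\<lambda>z. z + (1 + \<omega>) / 3) zs"
proof -
  define c where "c = (1 + \<omega>) / 3"
  define zs where "zs = map (\<lambda>x. x - c) xs"
  have xs: "xs = map (\<lambda>z. z + c) zs"
    by (simp add: zs_def comp_def)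
  have W: "zs \<noteq> []" "covering n zs" "successively (\<lambda>p q. dist p q = 1) zs"
    "hd zs = 0" "last zs = of_nat (n - 1)" "successively allowed_turn (0 # directions zs @ [0])"
    using assms(2)
    by (auto simp: W_paths_def H_paths_def xs directions_translate inscribed_grid_altdef inj_image_eq_iff
        successively_map hd_map last_map centroid_dark_tile covering_def distinct_map simp flip: c_def)
  let ?t = "supplemented n zs"
  have "\<exists>p. p \<in> dark_tile (?t ! i) \<and> p \<in> dark_tile (?t ! Suc i)" if i: "i \<le> length zs" for i
  proof -
    \<comment> \<open>At both ends the prescribed first and last tiles touch the outer ones; in
      between, adjacency of centroids supplies the corner.\<close>
    consider "i = 0" | "i = length zs" "i > 0" | k where "i = Suc k" "Suc k < length zs"
      using i by (cases i) force+
    then show ?thesis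
    proof cases
      case 1
      then have "?t ! i = -1" "?t ! Suc i = 0"
        using W(1,4) by (simp_all add: nth_supplemented hd_conv_nth)
      then show ?thesis
        by (auto simp: dark_tile_def)
    next
      case 2
      then have "?t ! i = of_nat (n - 1)" "?t ! Suc i = of_nat n"
        using W(1,5) nth_supplemented(2)[of "i - 1" zs n] nth_supplemented(3)[of n zs]
        by (simp_all add: last_conv_nth)
      then show ?thesis
        using assms(1) by (auto simp: dark_tile_def of_nat_diff)
    next
      case 3
      then have "zs ! k \<in> tile_bases n" "zs ! Suc k \<in> tile_bases n" "dist (zs ! k) (zs ! Suc k) = 1"
        using W(2,3) nth_mem[of _ zs] by (auto simp: covering_def successively_conv_nth)
      then show ?thesis
        using 3 adjacent_tiles_meet by (simp add: nth_supplemented)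
    qed
  qed
  then obtain f where f: "\<And>i. i \<le> length zs \<Longrightarrow> f i \<in> dark_tile (?t ! i) \<and> f i \<in> dark_tile (?t ! Suc i)"
    by metis
  define P where "P = map f [0..<Suc (length zs)]"
  have "interlaced n zs P"
    using f by (simp add: interlaced_def P_def del: upt_Suc)
  then have "tour n zs P"
    using well_formed_iff_distinct assms(1) W(2,6) by (auto simp: tour_def)
  then show ?thesis
    using that xs c_def by blast
qed

theorem theorem1:
  fixes n :: nat
  assumes "n \<ge> 1"
  shows "bij_betw (Phi n) (S_paths n) (W_paths n) \<and> card (W_paths n) = card (S_paths n)"
proof -
  have "inj_on (Phi n) (S_paths n)"
  proof (rule inj_onI)
    fix P Q
    assume PQ: "P \<in> S_paths n" "Q \<in> S_paths n" "Phi n P = Phi n Q"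
    obtain zs ys where tours: "tour n zs P" "tour n ys Q"
      using S_path_tour PQ(1,2) by metis
    \<comment> \<open>\<open>Phi\<close> records the tile sequence up to an injective
      translation.\<close>
    then have "zs = ys"
      using PQ(3) by (simp add: tour_Phi inj_map_eq_map inj_def)
    then show "P = Q"
      using tours assms tour_unique by blast
  qed
  moreover have "Phi n ` S_paths n = W_paths n"
  proof (intro set_eqI iffI)
    fix xs
    assume "xs \<in> Phi n ` S_paths n"
    then obtain P where P: "P \<in> S_paths n" "xs = Phi n P"
      by blast
    obtain zs where "tour n zs P"
      using S_path_tour P(1) by blast
    then show "xs \<in> W_paths n"
      using assms P(2) by (simp add: tour_Phi tour_in_W_paths)
  next
    fix xs
    assume "xs \<in> W_paths n"
    then obtain zs P where "tour n zs P" "xs = map (\<lambda>z. z + (1 + \<omega>) / 3) zs"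
      using W_path_tour assms by blast
    then show "xs \<in> Phi n ` S_paths n"
      using assms tour_in_S_paths tour_Phi by (metis image_eqI)
  qed
  ultimately have "bij_betw (Phi n) (S_paths n) (W_paths n)"
    by (simp add: bij_betw_def)
  then show ?thesis
    using bij_betw_same_card by metis
qed

end
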